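(* For a channel that dies $(\mathcal{X},p_a(y|x),p_d(y|x),p_T(t),\mathcal{Y})$, channel state feedback does not improve performance. That is, for every positive integer $N$ and $0<\eta<1$, in the dynamic programming formulation of the problem of choosing transmission epochs so as to maximize the expected transmission volume $$V=\mathrm{E}\left[\sum_{n=1}^N(1-\hat s_n)\,\omega_n\log M^{*}(\zeta_n+1,\eta)\right],$$ the maximum of $V$ over control policies in which $\hat s_n$ may depend on $n$, $\zeta_n$ and the channel state $\omega_n$ equals the maximum of $V$ over control policies in which $\hat s_n$ depends only on $n$ and $\zeta_n$.
   Context: A channel that dies acts as a discrete memoryless channel $p_a(y|x)$ (alive state) at times $1,\dots,T$ and outputs only an erasure symbol $?$ (dead state) at times $T+1,T+2,\dots$, where $T$ is a random positive integer with distribution $p_T$. $R_T(t)=\Pr[T>t]$, with $R_T(1)=1$. $M^{*}(n,\eta)$ is the largest size of a code of length $n$ for $p_a$ with maximal error probability at most $\eta$. Channel state feedback means that the transmitter knows whether the channel output is $?$ or some other symbol. Dynamic programming formulation: the state $(\zeta_n,\omega_n)$ starts at $(\zeta_1,\omega_1)=(0,1)$ and evolves by $$\zeta_{n+1}=(\zeta_n+1)\hat s_n,\qquad \omega_{n+1}=\omega_n\kappa_n,\qquad n=1,\dots,N.$$ Here $\zeta_n\in\{0,1,2,\dots\}$ counts the location in the current transmission epoch; $\omega_n\in\{0,1\}$ indicates whether the channel is alive ($1$) or dead ($0$); $\kappa_n\in\{0,1\}$ is a disturbance with $\Pr[\kappa_n=1]=R_T(n)$, independent over $n$; $\hat s_n\in\{0,1\}$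 is the control, which starts ($0$) or continues ($1$) a transmission epoch in the next time step. Transmission volume $\log M^{*}(\zeta_n+1,\eta)$ is credited at time $n$ if $\omega_n=1$ and $\hat s_n=0$. There is no terminal cost. *)

theory Defs
  imports "HOL-Probability.Probability"
begin

text \<open>The alphabets are the finite types \<open>'x\<close> and \<open>'y\<close>. The output alphabet
  contains the erasure symbol \<open>era\<close>.\<close>

definition survival :: "nat pmf \<Rightarrow> nat \<Rightarrow> real" where
  "survival pT t = measure_pmf.prob pT {t<..}"

text \<open>\<open>pa\<close> is arbitrary: any transition probabilities are allowed while the channel is alive.\<close>

definition channel_that_dies ::
  "('x \<Rightarrow> 'y pmf) \<Rightarrow> ('x \<Rightarrow> 'y pmf) \<Rightarrow> 'y \<Rightarrow> nat pmf \<Rightarrow> bool" where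
  "channel_that_dies pa pd era pT \<longleftrightarrow>
     (\<forall>x. pd x = return_pmf era) \<and> set_pmf pT \<subseteq> {1..} \<and> survival pT 1 = 1"


text \<open>Block codes for a discrete memoryless channel, with messages \<open>0, \<dots>, M - 1\<close> and
  deterministic encoder and decoder.\<close>

definition word_prob :: "('x \<Rightarrow> 'y pmf) \<Rightarrow> 'x list \<Rightarrow> 'y list \<Rightarrow> real" where
  "word_prob p xs ys = (\<Prod>i<length xs. pmf (p (xs ! i)) (ys ! i))"

definition block_code :: "nat \<Rightarrow> nat \<Rightarrow> (nat \<Rightarrow> 'x list) \<Rightarrow> ('y list \<Rightarrow> nat) \<Rightarrow> bool" where
  "block_code n M f g \<longleftrightarrow>
     (\<forall>m<M. length (f m) = n) \<and> (\<forall>ys. length ys = n \<longrightarrow> g ys < M)"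

definition error_prob ::
  "('x \<Rightarrow> 'y pmf) \<Rightarrow> nat \<Rightarrow> (nat \<Rightarrow> 'x list) \<Rightarrow> ('y list \<Rightarrow> nat) \<Rightarrow> nat \<Rightarrow> real" where
  "error_prob p n f g m = (\<Sum>ys | length ys = n \<and> g ys \<noteq> m. word_prob p (f m) ys)"

definition code_sizes :: "('x \<Rightarrow> 'y pmf) \<Rightarrow> nat \<Rightarrow> real \<Rightarrow> nat set" where
  "code_sizes p n \<eta> = {M. \<exists>f g. block_code n M f g \<and> (\<forall>m<M. error_prob p n f g m \<le> \<eta>)}"

definition M_star :: "('x \<Rightarrow> 'y pmf) \<Rightarrow> nat \<Rightarrow> real \<Rightarrow> nat" where
  "M_star p n \<eta> = Max (code_sizes p n \<eta>)"

text \<open>The maximum defining \<open>M_star\<close> exists.\<close>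

lemma sum_word_prob:
  fixes p :: "'x \<Rightarrow> 'y::finite pmf"
  shows "(\<Sum>ys | length ys = length xs. word_prob p xs ys) = 1"
proof (induction xs)
  case Nil
  have "{ys :: 'y list. length ys = 0} = {[]}" by auto
  then show ?case by (simp add: word_prob_def)
next
  case (Cons x xs)
  let ?L = "{ys :: 'y list. length ys = length xs}"
  have eq: "{ys :: 'y list. length ys = length (x # xs)} = (\<lambda>(y, ys). y # ys) ` (UNIV \<times> ?L)"
    by (auto simp: image_iff length_Suc_conv)
  have inj: "inj_on (\<lambda>(y, ys). y # ys) (UNIV \<times> ?L)" by (auto simp: inj_on_def)
  have wp: "word_prob p (x # xs) (y # ys) = pmf (p x) y * word_prob p xs ys" for y ys
    by (simp add: word_prob_def prod.lessThan_Suc_shift del: prod.lessThan_Suc)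
  have "(\<Sum>ys | length ys = length (x # xs). word_prob p (x # xs) ys)
      = (\<Sum>(y, ys) \<in> UNIV \<times> ?L. pmf (p x) y * word_prob p xs ys)"
    unfolding eq sum.reindex[OF inj] by (simp add: wp case_prod_beta o_def)
  also have "\<dots> = (\<Sum>y\<in>UNIV. pmf (p x) y) * (\<Sum>ys\<in>?L. word_prob p xs ys)"
    by (simp add: sum.cartesian_product[symmetric] sum_product)
  also have "(\<Sum>y\<in>UNIV. pmf (p x) y) = 1" by (rule sum_pmf_eq_1) auto
  finally show ?case using Cons by simp
qed

lemma finite_words: "finite {ys :: 'y::finite list. length ys = n}"
  using finite_lists_length_eq[of "UNIV :: 'y set" n] by simp

lemma code_sizes_nonempty:
  fixes p :: "'x \<Rightarrow> 'y::finite pmf"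
  assumes "0 < \<eta>"
  shows "1 \<in> code_sizes p n \<eta>"
proof -
  have "block_code n 1 (\<lambda>_. replicate n undefined :: 'x list) (\<lambda>_ :: 'y list. 0)"
    by (simp add: block_code_def)
  moreover have "error_prob p n (\<lambda>_. replicate n undefined) (\<lambda>_. 0) 0 \<le> \<eta>"
    using assms by (simp add: error_prob_def)
  ultimately show ?thesis unfolding code_sizes_def by fastforce
qed

lemma finite_code_sizes:
  fixes p :: "'x \<Rightarrow> 'y::finite pmf"
  assumes "\<eta> < 1"
  shows "finite (code_sizes p n \<eta>)"
proof -
  let ?L = "{ys :: 'y list. length ys = n}"
  have le1: "word_prob p xs ys \<le> 1" for xs and ys :: "'y list"
    unfolding word_prob_def by (intro prod_le_1) (auto simp: pmf_le_1)
  have "real M * (1 - \<eta>) \<le> card ?L" if "M \<in> code_sizes p n \<eta>" for M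
  proof -
    from that obtain f g where c: "block_code n M f g"
      and e: "\<And>m. m < M \<Longrightarrow> error_prob p n f g m \<le> \<eta>"
      by (auto simp: code_sizes_def)
    have "real M * (1 - \<eta>) = (\<Sum>m<M. 1 - \<eta>)" by simp
    also have "\<dots> \<le> (\<Sum>m<M. \<Sum>ys | ys \<in> ?L \<and> g ys = m. word_prob p (f m) ys)"
    proof (rule sum_mono)
      fix m assume "m \<in> {..<M}"
      then have m: "m < M" by simp
      have "1 = (\<Sum>ys\<in>?L. word_prob p (f m) ys)"
        using sum_word_prob[of p "f m"] c m by (simp add: block_code_def)
      also have "?L = {ys. ys \<in> ?L \<and> g ys = m} \<union> {ys. length ys = n \<and> g ys \<noteq> m}" by auto
      also have "(\<Sum>ys\<in>\<dots>. word_prob p (f m) ys)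
          = (\<Sum>ys | ys \<in> ?L \<and> g ys = m. word_prob p (f m) ys) + error_prob p n f g m"
        unfolding error_prob_def
        by (rule sum.union_disjoint) (auto intro: finite_subset[OF _ finite_words[of n]])
      finally show "1 - \<eta> \<le> (\<Sum>ys | ys \<in> ?L \<and> g ys = m. word_prob p (f m) ys)"
        using e[OF m] by linarith
    qed
    also have "\<dots> \<le> (\<Sum>m<M. \<Sum>ys | ys \<in> ?L \<and> g ys = m. 1)"
      by (intro sum_mono le1)
    also have "\<dots> = (\<Sum>ys\<in>?L. 1)"
      by (rule sum.group) (use c finite_words in \<open>auto simp: block_code_def\<close>)
    finally show ?thesis by simp
  qed
  then have "code_sizes p n \<eta> \<subseteq> {..nat \<lfloor>card ?L / (1 - \<eta>)\<rfloor>}"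
    using assms by (auto simp: le_nat_floor pos_le_divide_eq)
  then show ?thesis by (rule finite_subset) simp
qed


text \<open>In the dynamic program, \<open>True\<close> stands for 1 and \<open>False\<close> for 0. A policy \<open>s\<close>
  yields the control \<open>s n \<zeta> \<omega>\<close> at time \<open>n\<close> in state \<open>(\<zeta>, \<omega>)\<close>.\<close>

type_synonym policy = "nat \<Rightarrow> nat \<Rightarrow> bool \<Rightarrow> bool"

text \<open>Time starts at 1; the value at time 0 is a dummy.\<close>

fun dp_state :: "policy \<Rightarrow> (nat \<Rightarrow> bool) \<Rightarrow> nat \<Rightarrow> nat \<times> bool" where
  "dp_state s k 0 = (0, True)"
| "dp_state s k (Suc 0) = (0, True)"
| "dp_state s k (Suc (Suc n)) =
     (let (\<zeta>, \<omega>) = dp_state s k (Suc n)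
      in ((\<zeta> + 1) * of_bool (s (Suc n) \<zeta> \<omega>), \<omega> \<and> k (Suc n)))"

definition volume_credit ::
  "('x \<Rightarrow> 'y pmf) \<Rightarrow> real \<Rightarrow> policy \<Rightarrow> (nat \<Rightarrow> bool) \<Rightarrow> nat \<Rightarrow> real" where
  "volume_credit p \<eta> s k n =
     (let (\<zeta>, \<omega>) = dp_state s k n
      in (1 - of_bool (s n \<zeta> \<omega>)) * of_bool \<omega> * log 2 (real (M_star p (\<zeta> + 1) \<eta>)))"

definition death_disturbances ::
  "'w measure \<Rightarrow> nat pmf \<Rightarrow> nat \<Rightarrow> (nat \<Rightarrow> 'w \<Rightarrow> bool) \<Rightarrow> bool" where
  "death_disturbances P pT N \<kappa> \<longleftrightarrow>
     prob_space P \<and>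
     prob_space.indep_vars P (\<lambda>_. count_space UNIV) \<kappa> {1..N} \<and>
     (\<forall>n\<in>{1..N}. measure P {w \<in> space P. \<kappa> n w} = survival pT n)"

definition expected_volume ::
  "'w measure \<Rightarrow> (nat \<Rightarrow> 'w \<Rightarrow> bool) \<Rightarrow> ('x \<Rightarrow> 'y pmf) \<Rightarrow> real \<Rightarrow> nat \<Rightarrow> policy \<Rightarrow> real" where
  "expected_volume P \<kappa> p \<eta> N s =
     (\<integral>w. (\<Sum>n=1..N. volume_credit p \<eta> s (\<lambda>i. \<kappa> i w) n) \<partial>P)"

definition no_feedback_policy :: "policy \<Rightarrow> bool" where
  "no_feedback_policy s \<longleftrightarrow> (\<forall>n \<zeta> \<omega> \<omega>'. s n \<zeta> \<omega> = s n \<zeta> \<omega>')"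

end

theory Submission imports Defs begin

text \<open>Nothing is credited once the channel is dead, and until then the channel state carries no
  information. Hence the volume of a policy depends only on its controls \<open>s n \<zeta> True\<close>, and a policy
  may as well ignore \<open>\<omega>\<close>. Only the finitely many controls with \<open>n, \<zeta> \<le> N\<close> matter, so the
  maximum is attained.\<close>

text \<open>Confines the reachable counters at time \<open>n\<close> to a finite range, so that only
  finitely many controls can matter.\<close>

lemma dp_state_fst_le: "fst (dp_state s k n) \<le> n"
  by (induction s k n rule: dp_state.induct) (auto simp: Let_def case_prod_beta)

text \<open>A channel alive now was alive at every earlier time, so only controls at
  \<open>True\<close> have shaped its counter. After death the counters may diverge, hence the
  implication.\<close>

lemma dp_state_alive_cong:
  assumes "\<And>m \<zeta>. m < n \<Longrightarrow> \<zeta> \<le> m \<Longrightarrow> s m \<zeta> True = s' m \<zeta> True"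
  shows "snd (dp_state s k n) = snd (dp_state s' k n) \<and>
    (snd (dp_state s k n) \<longrightarrow> fst (dp_state s k n) = fst (dp_state s' k n))"
  using assms
proof (induction s k n rule: dp_state.induct)
  case (3 s k n)
  have IH: "snd (dp_state s k (Suc n)) = snd (dp_state s' k (Suc n))"
    "snd (dp_state s k (Suc n)) \<Longrightarrow> fst (dp_state s k (Suc n)) = fst (dp_state s' k (Suc n))"
    using "3.IH" "3.prems" by auto
  then show ?case
    using "3.prems"[OF _ dp_state_fst_le[of s' k "Suc n"]] by (auto simp: Let_def case_prod_beta)
qed simp_all

text \<open>The factor \<open>of_bool \<omega>\<close> hides the diverging counters of a dead
  channel. The credit also uses the control at time \<open>n\<close> itself, hence
  \<open>m \<le> n\<close>.\<close>

lemma volume_credit_cong: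
  assumes "\<And>m \<zeta>. m \<le> n \<Longrightarrow> \<zeta> \<le> m \<Longrightarrow> s m \<zeta> True = s' m \<zeta> True"
  shows "volume_credit p \<eta> s k n = volume_credit p \<eta> s' k n"
proof -
  have "snd (dp_state s k n) = snd (dp_state s' k n) \<and>
    (snd (dp_state s k n) \<longrightarrow> fst (dp_state s k n) = fst (dp_state s' k n))"
    by (rule dp_state_alive_cong) (use assms in auto)
  then show ?thesis
    using assms[OF order_refl dp_state_fst_le[of s' k n]]
    by (cases "snd (dp_state s k n)") (simp_all add: volume_credit_def case_prod_beta)
qed

lemma expected_volume_cong:
  assumes "\<And>m \<zeta>. m \<le> N \<Longrightarrow> \<zeta> \<le> m \<Longrightarrow> s m \<zeta> True = s' m \<zeta> True"
  shows "expected_volume P \<kappa> p \<eta> N s = expected_volume P \<kappa> p \<eta> N s'"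
proof -
  have "volume_credit p \<eta> s k n = volume_credit p \<eta> s' k n" if "n \<in> {1..N}" for k n
    by (rule volume_credit_cong) (use assms that in auto)
  then show ?thesis
    unfolding expected_volume_def
    by (intro Bochner_Integration.integral_cong sum.cong refl)
qed

theorem proposition14:
  fixes pa :: "'x::finite \<Rightarrow> 'y::finite pmf" and pd :: "'x \<Rightarrow> 'y pmf" and era :: 'y
    and pT :: "nat pmf"
    and P :: "'w measure" and \<kappa> :: "nat \<Rightarrow> 'w \<Rightarrow> bool"
    and N :: nat and \<eta> :: real
  assumes "channel_that_dies pa pd era pT"
    and "N \<ge> 1"
    and "0 < \<eta>" and "\<eta> < 1"
    and "death_disturbances P pT N \<kappa>"
  shows "\<exists>s s'. is_arg_max (expected_volume P \<kappa> pa \<eta> N) (\<lambda>_. True) s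
      \<and> is_arg_max (expected_volume P \<kappa> pa \<eta> N) no_feedback_policy s'
      \<and> expected_volume P \<kappa> pa \<eta> N s = expected_volume P \<kappa> pa \<eta> N s'"
proof -
  let ?V = "expected_volume P \<kappa> pa \<eta> N"
  \<comment> \<open>\<open>A\<close> lists the pairs at which the policy continues the epoch,
    whatever \<open>\<omega>\<close> is.\<close>
  define q :: "(nat \<times> nat) set \<Rightarrow> policy" where "q A = (\<lambda>n \<zeta> \<omega>. (n, \<zeta>) \<in> A)" for A
  let ?Q = "Pow ({..N} \<times> {..N})"
  have q_no_feedback: "no_feedback_policy (q A)" for A
    by (simp add: no_feedback_policy_def q_def)
  \<comment> \<open>The set records what \<open>s\<close> does while the channel is alive, within
    the times and counters that affect the volume.\<close>
  have "?V s = ?V (q {(n, \<zeta>) \<in> {..N} \<times> {..N}. s n \<zeta> True})" for s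
    by (rule expected_volume_cong) (auto simp: q_def)
  then have range: "?V s \<in> (?V \<circ> q) ` ?Q" for s
    by force
  have fin: "finite ((?V \<circ> q) ` ?Q)"
    by simp
  then have "Max ((?V \<circ> q) ` ?Q) \<in> (?V \<circ> q) ` ?Q"
    by (rule Max_in) auto
  then obtain A where "?V (q A) = Max ((?V \<circ> q) ` ?Q)"
    by auto
  then have "?V s \<le> ?V (q A)" for s
    using Max_ge[OF fin range] by simp
  \<comment> \<open>\<open>q A\<close> is optimal among all policies and itself ignores
    \<open>\<omega>\<close>, so it serves as both witnesses.\<close>
  then have "is_arg_max ?V (\<lambda>_. True) (q A)" "is_arg_max ?V no_feedback_policy (q A)"
    using q_no_feedback by (auto simp: is_arg_max_def not_less)
  then show ?thesis
    by blast
qed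

end
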